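(* Let $q$ be a prime power and fix an integer $m\ge 0$. For each $n\ge 0$, let $P_{m,n}$ be the probability that a uniformly random pair $(f,g)\in \mathrm{Hom}(V,W)\times\mathrm{Hom}(W,V)$, where $V$ and $W$ are $\mathbb{F}_q$-vector spaces of dimensions $m$ and $n$, is a nilpotent pair. Then $$\lim_{n\to\infty}P_{m,n}=q^{-m}.$$
   Context: A pair $(f,g)$ of linear maps $f:V\to W$, $g:W\to V$ is a nilpotent pair if $gf\in \mathrm{End}(V)$ is nilpotent (equivalently, $fg\in\mathrm{End}(W)$ is nilpotent). *)

theory Defs
  imports
    "Jordan_Normal_Form.Missing_VectorSpace"
    "HOL-Number_Theory.Prime_Powers"
    "HOL-Probability.Probability_Mass_Function"
begin

text \<open>
  \<^const>\<open>LinearCombinations.module_hom\<close> leaves the values of a map outside the carrier of its domain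
  unspecified. The intersection with \<^const>\<open>extensional\<close> makes each linear map be
  represented by exactly one HOL function, so that the uniform distribution on the resulting
  set is the uniform distribution on \<open>Hom(V, W)\<close>.
\<close>

definition lin_maps ::
  "('a, 'r) ring_scheme \<Rightarrow> ('a, 'v, 's) module_scheme \<Rightarrow> ('a, 'w, 't) module_scheme \<Rightarrow> ('v \<Rightarrow> 'w) set"
  where "lin_maps K V W = LinearCombinations.module_hom K V W \<inter> extensional (carrier V)"

definition nilpotent_on :: "('a, 'v, 's) module_scheme \<Rightarrow> ('v \<Rightarrow> 'v) \<Rightarrow> bool"
  where "nilpotent_on V h \<longleftrightarrow> (\<exists>k. \<forall>v\<in>carrier V. (h ^^ k) v = \<zero>\<^bsub>V\<^esub>)"

definition nilpotent_pair :: "('a, 'v, 's) module_scheme \<Rightarrow> ('v \<Rightarrow> 'w) \<Rightarrow> ('w \<Rightarrow> 'v) \<Rightarrow> bool"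
  where "nilpotent_pair V f g \<longleftrightarrow> nilpotent_on V (g \<circ> f)"

definition nilpotent_pair_prob ::
  "('a, 'r) ring_scheme \<Rightarrow> ('a, 'v, 's) module_scheme \<Rightarrow> ('a, 'w, 't) module_scheme \<Rightarrow> real"
  where "nilpotent_pair_prob K V W =
    measure_pmf.prob (pmf_of_set (lin_maps K V W \<times> lin_maps K W V))
      {(f, g). nilpotent_pair V f g}"

end

theory Submission
  imports Defs
begin

text \<open>
  Let \<open>V\<close> and \<open>W\<close> have dimensions \<open>m\<close> and \<open>n\<close>. A random map \<open>f\<close> from
  \<open>V\<close> to \<open>W\<close> fails to be injective with probability at most \<open>q\<^sup>m\<^sup>-\<^sup>n\<close>, by a
  union bound over the nonzero vectors that it could kill. If \<open>f\<close> is injective, then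
  \<open>g \<circ> f\<close> is uniformly distributed over the endomorphisms of \<open>V\<close>, because all fibres
  of \<open>g \<mapsto> g \<circ> f\<close> have the same size. So for large \<open>n\<close> the probability of a nilpotent
  pair tends to the probability that a random endomorphism of \<open>V\<close> is nilpotent, which is
  \<open>q\<^sup>-\<^sup>m\<close> by the theorem of Fine and Herstein (\<open>card_nilpotent_maps\<close>).

  The theorem of Fine and Herstein is proved by revealing a random endomorphism \<open>T\<close> along orbits.
  Start from a nonzero vector \<open>x\<close> and reveal \<open>T x, T\<^sup>2 x, \<dots>\<close> until the first
  \<open>T\<^sup>k x\<close> that depends on the earlier iterates. This last value is uniformly distributed over
  their span, and \<open>T\<close> can only be nilpotent if the value is zero, which has probability
  \<open>q\<^sup>-\<^sup>k\<close>. Then continue in the same way modulo the invariant subspace found so far. Since the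
  lengths \<open>k\<close> of the orbit segments add up to \<open>m\<close>, the product of the probabilities is
  \<open>q\<^sup>-\<^sup>m\<close> in all cases. No quotient spaces are formed: \<open>card_chain_maps_nilpotent\<close>
  carries an independent set \<open>S\<close> whose span is the invariant subspace, together with the
  unfinished orbit segment, and all cardinalities come from the number of linear maps with prescribed
  values on an independent set (\<open>card_lin_maps_prescribed\<close>). The step that relates nilpotency to
  the last value of a segment is \<open>nilpotent_chain_end_in_span\<close>.
\<close>

section \<open>Bases and cardinalities of finite vector spaces\<close>

context vectorspace
begin

lemma span_subset_closed:
  assumes "S \<subseteq> U" "U \<subseteq> carrier V" "\<zero>\<^bsub>V\<^esub> \<in> U"
    and "\<And>u v. u \<in> U \<Longrightarrow> v \<in> U \<Longrightarrow> u \<oplus>\<^bsub>V\<^esub> v \<in> U"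
    and "\<And>c u. c \<in> carrier K \<Longrightarrow> u \<in> U \<Longrightarrow> c \<odot>\<^bsub>V\<^esub> u \<in> U"
  shows "span S \<subseteq> U"
proof (rule span_is_subset[OF assms(1)])
  show "submodule K U V"
    unfolding submodule_def using assms module_axioms by auto
qed

lemma span_mono: "A \<subseteq> B \<Longrightarrow> span A \<subseteq> span B"
  unfolding span_def by blast

lemma insert_lin_indpt_iff:
  assumes "S \<subseteq> carrier V" "lin_indpt S" "v \<in> carrier V"
  shows "v \<notin> span S \<longleftrightarrow> v \<notin> S \<and> lin_indpt (insert v S)"
  using lin_dep_iff_in_span[OF assms] in_own_span[OF assms(1)] by auto

lemma lin_indpt_extends_to_basis:
  assumes "fin_dim" "S \<subseteq> carrier V" "lin_indpt S"
  obtains B where "finite B" "S \<subseteq> B" "basis B"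
proof -
  let ?P = "\<lambda>A. S \<subseteq> A \<and> A \<subseteq> carrier V \<and> lin_indpt A"
  have "\<exists>A. finite A \<and> maximal A ?P"
    by (rule maximal_exists[where B = S and N = dim]) (use assms li_le_dim in auto)
  then obtain B where B: "finite B" "maximal B ?P" by blast
  then have "maximal B (\<lambda>A. A \<subseteq> carrier V \<and> lin_indpt A)"
    unfolding maximal_def by (metis subset_trans)
  then have "basis B" by (rule max_li_is_basis)
  with B show ?thesis by (auto intro: that simp: maximal_def)
qed

lemma lin_indpt_spans_if_maximal:
  assumes "fin_dim" "S \<subseteq> carrier V" "lin_indpt S" "dim \<le> card S"
  shows "span S = carrier V"
  using dim_li_is_basis[of S] li_le_dim[of S] assms by (auto simp: basis_def)

lemma basis_coefficients_bij:
  assumes "finite B" "basis B"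
  shows "bij_betw (\<lambda>a. lincomb a B) (B \<rightarrow>\<^sub>E carrier K) (carrier V)"
proof -
  have B: "B \<subseteq> carrier V" using assms by (auto simp: basis_def)
  have ex1: "\<exists>!a. a \<in> B \<rightarrow>\<^sub>E carrier K \<and> lincomb a B = v" if "v \<in> carrier V" for v
    using basis_criterion[OF assms(1) B] assms(2) that by blast
  have "lincomb a B \<in> carrier V" if "a \<in> B \<rightarrow>\<^sub>E carrier K" for a
    using B that by (intro lincomb_closed) auto
  then show ?thesis
    unfolding bij_betw_def inj_on_def using ex1 by (auto simp: image_iff) metis+
qed

lemma card_carrier_eq:
  assumes "finite B" "basis B"
  shows "card (carrier V) = card (carrier K) ^ card B"
  using bij_betw_same_card[OF basis_coefficients_bij[OF assms]] assms(1)
  by (simp add: card_PiE)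

lemma finite_carrier:
  assumes "fin_dim" "finite (carrier K)"
  shows "finite (carrier V)"
proof -
  obtain B where B: "finite B" "basis B" using finite_basis_exists[OF assms(1)] by blast
  have "finite (B \<rightarrow>\<^sub>E carrier K)" using B assms by (intro finite_PiE) auto
  then show ?thesis using bij_betw_finite[OF basis_coefficients_bij[OF B]] by simp
qed

text \<open>
  The span is itself a vector space, with the given set as a basis, so that its cardinality is an
  instance of the count of the vectors of a whole space.
\<close>
lemma card_span_lin_indpt:
  assumes "finite S" "S \<subseteq> carrier V" "lin_indpt S"
  shows "card (span S) = card (carrier K) ^ card S"
proof -
  have sub: "VectorSpace.subspace K (span S) V" by (rule span_is_subspace[OF assms(2)])
  interpret U: vectorspace K "vs (span S)" by (rule subspace_is_vs[OF sub])
  have own: "S \<subseteq> span S" by (rule in_own_span[OF assms(2)])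
  have "U.basis S"
    unfolding U.basis_def
    using span_li_not_depend[OF own is_module[OF sub]] assms(3) own by simp
  from U.card_carrier_eq[OF assms(1) this] show ?thesis by simp
qed

end

section \<open>Linear maps with prescribed values on an independent set\<close>

lemma lin_mapsD:
  assumes "T \<in> lin_maps K V W"
  shows "v \<in> carrier V \<Longrightarrow> T v \<in> carrier W"
    and "u \<in> carrier V \<Longrightarrow> v \<in> carrier V \<Longrightarrow> T (u \<oplus>\<^bsub>V\<^esub> v) = T u \<oplus>\<^bsub>W\<^esub> T v"
    and "c \<in> carrier K \<Longrightarrow> v \<in> carrier V \<Longrightarrow> T (c \<odot>\<^bsub>V\<^esub> v) = c \<odot>\<^bsub>W\<^esub> T v"
  using assms by (auto simp: lin_maps_def LinearCombinations.module_hom_def)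

lemma lin_maps_zero:
  assumes "vectorspace K V" "vectorspace K W" "T \<in> lin_maps K V W"
  shows "T \<zero>\<^bsub>V\<^esub> = \<zero>\<^bsub>W\<^esub>"
proof -
  interpret V: vectorspace K V by fact
  interpret W: vectorspace K W by fact
  interpret mod_hom K V W T
    using assms(3) by unfold_locales (auto simp: lin_maps_def)
  show ?thesis by simp
qed

lemma finite_lin_maps:
  assumes "finite (carrier V)" "finite (carrier W)"
  shows "finite (lin_maps K V W)"
proof (rule finite_subset)
  show "lin_maps K V W \<subseteq> carrier V \<rightarrow>\<^sub>E carrier W"
    by (auto simp: lin_maps_def LinearCombinations.module_hom_def PiE_def)
  show "finite (carrier V \<rightarrow>\<^sub>E carrier W)" using assms by (intro finite_PiE) auto
qed

lemma lin_maps_eqI: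
  assumes "vectorspace K V" "vectorspace K W"
    and T: "T \<in> lin_maps K V W" and T': "T' \<in> lin_maps K V W"
    and B: "vectorspace.basis K V B"
    and eq: "\<And>b. b \<in> B \<Longrightarrow> T b = T' b"
  shows "T = T'"
proof -
  interpret V: vectorspace K V by fact
  interpret W: vectorspace K W by fact
  have "V.span B \<subseteq> {v \<in> carrier V. T v = T' v}"
    using B eq lin_mapsD[OF T] lin_mapsD[OF T'] lin_maps_zero[OF assms(1,2) T] lin_maps_zero[OF assms(1,2) T']
    by (intro V.span_subset_closed) (auto simp: V.basis_def)
  then have "T v = T' v" if "v \<in> carrier V" for v
    using B that by (auto simp: V.basis_def)
  moreover have "T \<in> extensional (carrier V)" "T' \<in> extensional (carrier V)"
    using T T' by (auto simp: lin_maps_def)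
  ultimately show ?thesis by (rule extensionalityI[rotated 2])
qed

text \<open>
  The extension sends a vector to the combination of the prescribed values that has the same
  coefficients. Linearity holds because coefficients with respect to a basis are unique: those of a
  sum, of a multiple and of a basis vector must be the expected ones.
\<close>
lemma lin_maps_extend:
  assumes "vectorspace K V" "vectorspace K W"
    and B: "finite B" "vectorspace.basis K V B" and \<phi>: "\<And>b. b \<in> B \<Longrightarrow> \<phi> b \<in> carrier W"
  obtains T where "T \<in> lin_maps K V W" "\<And>b. b \<in> B \<Longrightarrow> T b = \<phi> b"
proof -
  interpret V: vectorspace K V by fact
  interpret W: vectorspace K W by fact
  have BV: "B \<subseteq> carrier V" using B by (simp add: V.basis_def)
  define co where "co v = the_inv_into (B \<rightarrow>\<^sub>E carrier K) (\<lambda>a. V.lincomb a B) v" for v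
  note bij = V.basis_coefficients_bij[OF B]
  have co: "co v \<in> B \<rightarrow>\<^sub>E carrier K" "V.lincomb (co v) B = v" if "v \<in> carrier V" for v
    using that the_inv_into_into[OF bij_betw_imp_inj_on[OF bij]] f_the_inv_into_f_bij_betw[OF bij]
      bij_betw_imp_surj_on[OF bij] unfolding co_def by auto
  have coK: "co v b \<in> carrier K" if "v \<in> carrier V" "b \<in> B" for v b
    using co(1)[OF that(1)] that(2) by auto
  have co_unique: "co v b = a b" if "a \<in> B \<rightarrow> carrier K" "V.lincomb a B = v" "b \<in> B" for a v b
  proof -
    have "V.lincomb (restrict a B) B = v"
      using that BV by (subst V.lincomb_cong[where b = a]) auto
    then have "co v = restrict a B"
      unfolding co_def using that bij_betw_imp_inj_on[OF bij] the_inv_into_f_f by fastforce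
    then show ?thesis using that by simp
  qed
  define T where "T = restrict (\<lambda>v. \<Oplus>\<^bsub>W\<^esub>b\<in>B. co v b \<odot>\<^bsub>W\<^esub> \<phi> b) (carrier V)"
  have T_lincomb: "T (V.lincomb a B) = (\<Oplus>\<^bsub>W\<^esub>b\<in>B. a b \<odot>\<^bsub>W\<^esub> \<phi> b)" if a: "a \<in> B \<rightarrow> carrier K" for a
  proof -
    have "V.lincomb a B \<in> carrier V" using BV a by auto
    then show ?thesis
      unfolding T_def using a \<phi> co_unique[OF a refl]
      by (auto intro!: W.finsum_cong')
  qed
  have "T \<in> lin_maps K V W"
    unfolding lin_maps_def LinearCombinations.module_hom_def
  proof (intro IntI CollectI conjI allI impI)
    show "T \<in> extensional (carrier V)" by (simp add: T_def)
    show "T \<in> carrier V \<rightarrow> carrier W"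
      using coK \<phi> by (auto simp: T_def intro!: W.finsum_closed)
  next
    fix u v assume uv: "u \<in> carrier V \<and> v \<in> carrier V"
    have "u \<oplus>\<^bsub>V\<^esub> v = V.lincomb (\<lambda>b. co u b \<oplus>\<^bsub>K\<^esub> co v b) B"
    proof -
      have "co u \<in> B \<rightarrow> carrier K" "co v \<in> B \<rightarrow> carrier K" using coK uv by auto
      then show ?thesis using V.lincomb_sum[OF B(1) BV] co(2) uv by simp
    qed
    moreover have "(\<lambda>b. co u b \<oplus>\<^bsub>K\<^esub> co v b) \<in> B \<rightarrow> carrier K" using coK uv by auto
    ultimately have "T (u \<oplus>\<^bsub>V\<^esub> v) = (\<Oplus>\<^bsub>W\<^esub>b\<in>B. (co u b \<oplus>\<^bsub>K\<^esub> co v b) \<odot>\<^bsub>W\<^esub> \<phi> b)"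
      using T_lincomb by simp
    also have "\<dots> = (\<Oplus>\<^bsub>W\<^esub>b\<in>B. co u b \<odot>\<^bsub>W\<^esub> \<phi> b \<oplus>\<^bsub>W\<^esub> co v b \<odot>\<^bsub>W\<^esub> \<phi> b)"
      using coK uv \<phi> by (intro W.finsum_cong') (auto simp: W.smult_l_distr)
    also have "\<dots> = T u \<oplus>\<^bsub>W\<^esub> T v"
      using coK uv \<phi> by (auto simp: T_def intro!: W.finsum_addf)
    finally show "T (u \<oplus>\<^bsub>V\<^esub> v) = T u \<oplus>\<^bsub>W\<^esub> T v" .
  next
    fix c v assume cv: "c \<in> carrier K \<and> v \<in> carrier V"
    have "c \<odot>\<^bsub>V\<^esub> v = V.lincomb (\<lambda>b. c \<otimes>\<^bsub>K\<^esub> co v b) B"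
    proof -
      have "co v \<in> B \<rightarrow> carrier K" using coK cv by auto
      then show ?thesis using V.lincomb_smult[OF BV] co(2) cv by simp
    qed
    moreover have "(\<lambda>b. c \<otimes>\<^bsub>K\<^esub> co v b) \<in> B \<rightarrow> carrier K" using coK cv by auto
    ultimately have "T (c \<odot>\<^bsub>V\<^esub> v) = (\<Oplus>\<^bsub>W\<^esub>b\<in>B. (c \<otimes>\<^bsub>K\<^esub> co v b) \<odot>\<^bsub>W\<^esub> \<phi> b)"
      using T_lincomb by simp
    also have "\<dots> = (\<Oplus>\<^bsub>W\<^esub>b\<in>B. c \<odot>\<^bsub>W\<^esub> (co v b \<odot>\<^bsub>W\<^esub> \<phi> b))"
      using coK cv \<phi> by (intro W.finsum_cong') (auto simp: W.smult_assoc1)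
    also have "\<dots> = c \<odot>\<^bsub>W\<^esub> T v"
      using coK cv \<phi> B(1) by (auto simp: T_def intro!: W.finsum_smult[symmetric])
    finally show "T (c \<odot>\<^bsub>V\<^esub> v) = c \<odot>\<^bsub>W\<^esub> T v" .
  qed
  moreover have "T b = \<phi> b" if "b \<in> B" for b
  proof -
    have "V.lincomb (\<lambda>b'. if b' = b then \<one>\<^bsub>K\<^esub> else \<zero>\<^bsub>K\<^esub>) B = b"
    proof -
      have "V.lincomb (\<lambda>b'. if b' = b then \<one>\<^bsub>K\<^esub> else \<zero>\<^bsub>K\<^esub>) B
          = (\<Oplus>\<^bsub>V\<^esub>b'\<in>B. if b = b' then b' else \<zero>\<^bsub>V\<^esub>)"
        unfolding V.lincomb_def using BV that by (intro V.finsum_cong') auto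
      also have "\<dots> = b" using BV that B(1) by (intro V.finsum_singleton) auto
      finally show ?thesis .
    qed
    moreover have "(\<Oplus>\<^bsub>W\<^esub>b'\<in>B. (if b' = b then \<one>\<^bsub>K\<^esub> else \<zero>\<^bsub>K\<^esub>) \<odot>\<^bsub>W\<^esub> \<phi> b') = \<phi> b"
    proof -
      have "(\<Oplus>\<^bsub>W\<^esub>b'\<in>B. (if b' = b then \<one>\<^bsub>K\<^esub> else \<zero>\<^bsub>K\<^esub>) \<odot>\<^bsub>W\<^esub> \<phi> b')
          = (\<Oplus>\<^bsub>W\<^esub>b'\<in>B. if b = b' then \<phi> b' else \<zero>\<^bsub>W\<^esub>)"
        using \<phi> that by (intro W.finsum_cong') auto
      also have "\<dots> = \<phi> b" using \<phi> that B(1) by (intro W.finsum_singleton) auto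
      finally show ?thesis .
    qed
    ultimately show ?thesis using T_lincomb[of "\<lambda>b'. if b' = b then \<one>\<^bsub>K\<^esub> else \<zero>\<^bsub>K\<^esub>"] by auto
  qed
  ultimately show ?thesis by (rule that)
qed

text \<open>
  This is the only source of cardinalities of sets of linear maps below. Completing \<open>S\<close> to a
  basis \<open>B\<close>, a map with the prescribed values amounts to a free choice of its values on
  \<open>B - S\<close>. In particular the number of such maps depends on \<open>S\<close> only through
  its size, and not on the prescribed values.
\<close>
lemma card_lin_maps_prescribed:
  assumes "vectorspace K V" "vectorspace K W" "vectorspace.fin_dim K V"
    and S: "S \<subseteq> carrier V" "\<not> LinearCombinations.module.lin_dep K V S"
    and \<phi>: "\<And>s. s \<in> S \<Longrightarrow> \<phi> s \<in> carrier W"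
  shows "card {T \<in> lin_maps K V W. \<forall>s\<in>S. T s = \<phi> s}
    = card (carrier W) ^ (vectorspace.dim K V - card S)"
proof -
  interpret V: vectorspace K V by fact
  obtain B where B: "finite B" "S \<subseteq> B" "V.basis B"
    using V.lin_indpt_extends_to_basis assms(3) S by metis
  have BV: "B \<subseteq> carrier V" using B by (simp add: V.basis_def)
  let ?L = "{T \<in> lin_maps K V W. \<forall>s\<in>S. T s = \<phi> s}"
  have "bij_betw (\<lambda>T. restrict T (B - S)) ?L (B - S \<rightarrow>\<^sub>E carrier W)"
    unfolding bij_betw_def
  proof (intro conjI inj_onI subset_antisym subsetI)
    fix T T' assume T: "T \<in> ?L" and T': "T' \<in> ?L" and eq: "restrict T (B - S) = restrict T' (B - S)"
    have "T b = T' b" if "b \<in> B" for b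
    proof (cases "b \<in> S")
      case False
      with that eq show ?thesis by (metis DiffI restrict_apply')
    qed (use T T' in auto)
    with T T' show "T = T'" by (intro lin_maps_eqI[OF assms(1,2) _ _ B(3)]) auto
  next
    fix a assume "a \<in> (\<lambda>T. restrict T (B - S)) ` ?L"
    then obtain T where T: "T \<in> lin_maps K V W" "a = restrict T (B - S)" by blast
    have "T b \<in> carrier W" if "b \<in> B - S" for b
      using lin_mapsD(1)[OF T(1)] BV that by blast
    then show "a \<in> B - S \<rightarrow>\<^sub>E carrier W" unfolding T(2) by (rule restrict_PiE_iff[THEN iffD2, rule_format])
  next
    fix a assume a: "a \<in> B - S \<rightarrow>\<^sub>E carrier W"
    have "(if b \<in> S then \<phi> b else a b) \<in> carrier W" if "b \<in> B" for b
      using PiE_mem[OF a, of b] \<phi> that by simp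
    from lin_maps_extend[OF assms(1,2) B(1,3), where \<phi> = "\<lambda>b. if b \<in> S then \<phi> b else a b", OF this]
    obtain T where T: "T \<in> lin_maps K V W" "\<And>b. b \<in> B \<Longrightarrow> T b = (if b \<in> S then \<phi> b else a b)"
      by blast
    have "restrict T (B - S) = a"
      by (rule extensionalityI[of _ "B - S"]) (use PiE_ext T(2) a in \<open>auto simp: PiE_iff\<close>)
    moreover have "T \<in> ?L" using T B(2) by auto
    ultimately show "a \<in> (\<lambda>T. restrict T (B - S)) ` ?L" by blast
  qed
  then have "card ?L = card (B - S \<rightarrow>\<^sub>E carrier W)" by (rule bij_betw_same_card)
  also have "\<dots> = card (carrier W) ^ card (B - S)" using B(1) by (simp add: card_PiE)
  also have "card (B - S) = V.dim - card S"
    using B finite_subset[OF B(2,1)] by (simp add: V.dim_basis card_Diff_subset)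
  finally show ?thesis .
qed

lemma card_lin_maps:
  assumes "vectorspace K V" "vectorspace K W" "vectorspace.fin_dim K V"
  shows "card (lin_maps K V W) = card (carrier W) ^ vectorspace.dim K V"
proof -
  interpret V: vectorspace K V by fact
  have "V.lin_indpt {}" by (auto simp: V.lin_dep_def)
  then show ?thesis using card_lin_maps_prescribed[OF assms, of "{}"] by simp
qed

section \<open>Nilpotency tested on vectors\<close>

text \<open>
  The generalised eigenspace of \<open>T\<close> for the eigenvalue zero. It is a subspace, so that
  membership can be checked on generators, one exponent per generator. On a finite space the
  exponents have a common bound, and so \<open>T\<close> is nilpotent exactly when this is the whole space.
\<close>
definition eventual_kernel :: "('a, 'v, 's) module_scheme \<Rightarrow> ('v \<Rightarrow> 'v) \<Rightarrow> 'v set"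
  where "eventual_kernel V T = {v \<in> carrier V. \<exists>N. (T ^^ N) v = \<zero>\<^bsub>V\<^esub>}"

context vectorspace
begin

lemma funpow_lin_map:
  assumes T: "T \<in> lin_maps K V V"
  shows "v \<in> carrier V \<Longrightarrow> (T ^^ N) v \<in> carrier V"
    and "u \<in> carrier V \<Longrightarrow> v \<in> carrier V \<Longrightarrow> (T ^^ N) (u \<oplus>\<^bsub>V\<^esub> v) = (T ^^ N) u \<oplus>\<^bsub>V\<^esub> (T ^^ N) v"
    and "c \<in> carrier K \<Longrightarrow> v \<in> carrier V \<Longrightarrow> (T ^^ N) (c \<odot>\<^bsub>V\<^esub> v) = c \<odot>\<^bsub>V\<^esub> (T ^^ N) v"
    and "(T ^^ N) \<zero>\<^bsub>V\<^esub> = \<zero>\<^bsub>V\<^esub>"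
proof -
  have closed: "(T ^^ N) v \<in> carrier V" if "v \<in> carrier V" for v N
    using that by (induction N) (auto intro: lin_mapsD[OF T])
  then show "v \<in> carrier V \<Longrightarrow> (T ^^ N) v \<in> carrier V" .
  show "u \<in> carrier V \<Longrightarrow> v \<in> carrier V \<Longrightarrow> (T ^^ N) (u \<oplus>\<^bsub>V\<^esub> v) = (T ^^ N) u \<oplus>\<^bsub>V\<^esub> (T ^^ N) v"
    by (induction N) (simp_all add: lin_mapsD[OF T] closed)
  show "c \<in> carrier K \<Longrightarrow> v \<in> carrier V \<Longrightarrow> (T ^^ N) (c \<odot>\<^bsub>V\<^esub> v) = c \<odot>\<^bsub>V\<^esub> (T ^^ N) v"
    by (induction N) (simp_all add: lin_mapsD[OF T] closed)
  show "(T ^^ N) \<zero>\<^bsub>V\<^esub> = \<zero>\<^bsub>V\<^esub>"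
    by (induction N) (simp_all add: lin_maps_zero[OF vectorspace_axioms vectorspace_axioms T])
qed

lemma funpow_eq_zero_mono:
  assumes "T \<in> lin_maps K V V" "(T ^^ M) v = \<zero>\<^bsub>V\<^esub>" "M \<le> N"
  shows "(T ^^ N) v = \<zero>\<^bsub>V\<^esub>"
proof -
  have "(T ^^ N) v = (T ^^ (N - M)) ((T ^^ M) v)"
    using assms(3) by (metis comp_apply funpow_add le_add_diff_inverse2)
  then show ?thesis using assms funpow_lin_map(4) by simp
qed

lemma span_subset_eventual_kernel:
  assumes T: "T \<in> lin_maps K V V" and S: "S \<subseteq> eventual_kernel V T"
  shows "span S \<subseteq> eventual_kernel V T"
proof (rule span_subset_closed[OF S])
  show "eventual_kernel V T \<subseteq> carrier V" "\<zero>\<^bsub>V\<^esub> \<in> eventual_kernel V T"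
    by (auto simp: eventual_kernel_def intro: exI[of _ 0])
next
  fix u v assume "u \<in> eventual_kernel V T" "v \<in> eventual_kernel V T"
  then obtain M N where uv: "u \<in> carrier V" "v \<in> carrier V" "(T ^^ M) u = \<zero>\<^bsub>V\<^esub>" "(T ^^ N) v = \<zero>\<^bsub>V\<^esub>"
    by (auto simp: eventual_kernel_def)
  then have "(T ^^ max M N) u = \<zero>\<^bsub>V\<^esub>" "(T ^^ max M N) v = \<zero>\<^bsub>V\<^esub>"
    by (auto intro: funpow_eq_zero_mono[OF T])
  then have "(T ^^ max M N) (u \<oplus>\<^bsub>V\<^esub> v) = \<zero>\<^bsub>V\<^esub>" using uv funpow_lin_map(2)[OF T] by simp
  then show "u \<oplus>\<^bsub>V\<^esub> v \<in> eventual_kernel V T" using uv by (auto simp: eventual_kernel_def)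
next
  fix c v assume "c \<in> carrier K" "v \<in> eventual_kernel V T"
  then obtain N where "c \<in> carrier K" "v \<in> carrier V" "(T ^^ N) v = \<zero>\<^bsub>V\<^esub>"
    by (auto simp: eventual_kernel_def)
  moreover from this have "(T ^^ N) (c \<odot>\<^bsub>V\<^esub> v) = \<zero>\<^bsub>V\<^esub>"
    using funpow_lin_map(3)[OF T] by simp
  ultimately show "c \<odot>\<^bsub>V\<^esub> v \<in> eventual_kernel V T" by (auto simp: eventual_kernel_def)
qed

lemma nilpotent_on_iff_eventual_kernel:
  assumes T: "T \<in> lin_maps K V V" and fin: "finite (carrier V)"
  shows "nilpotent_on V T \<longleftrightarrow> carrier V \<subseteq> eventual_kernel V T"
proof
  assume "carrier V \<subseteq> eventual_kernel V T"
  then have "\<forall>v\<in>carrier V. \<exists>N. (T ^^ N) v = \<zero>\<^bsub>V\<^esub>" by (auto simp: eventual_kernel_def)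
  then obtain N where N: "\<And>v. v \<in> carrier V \<Longrightarrow> (T ^^ N v) v = \<zero>\<^bsub>V\<^esub>" by metis
  have "(T ^^ (Max (N ` carrier V))) v = \<zero>\<^bsub>V\<^esub>" if "v \<in> carrier V" for v
    using funpow_eq_zero_mono[OF T N[OF that]] fin that by simp
  then show "nilpotent_on V T" by (auto simp: nilpotent_on_def)
qed (auto simp: nilpotent_on_def eventual_kernel_def)

lemma span_invariant:
  assumes T: "T \<in> lin_maps K V V" and S: "S \<subseteq> carrier V" and inv: "\<And>s. s \<in> S \<Longrightarrow> T s \<in> span S"
  shows "v \<in> span S \<Longrightarrow> (T ^^ N) v \<in> span S"
proof -
  have span: "span S \<subseteq> carrier V" by (rule span_is_subset2[OF S])
  have sub: "submodule K (span S) V" by (rule is_module[OF span_is_subspace[OF S]])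
  have "span S \<subseteq> {v \<in> carrier V. T v \<in> span S}"
    using S inv lin_mapsD[OF T] lin_maps_zero[OF vectorspace_axioms vectorspace_axioms T] span_zero
      submodule.m_closed[OF sub] submodule.smult_closed[OF sub]
    by (intro span_subset_closed) auto
  then show "v \<in> span S \<Longrightarrow> (T ^^ N) v \<in> span S" by (induction N) auto
qed

text \<open>
  Modulo the invariant subspace \<open>span S\<close>, a vector that is killed by a power of \<open>T\<close>
  cannot be a combination of its own proper iterates unless it is already zero. Indeed, let
  \<open>N\<close> be the least exponent with \<open>T\<^sup>N y\<close> in \<open>span S\<close>. If
  \<open>N\<close> were positive, then \<open>T\<^sup>N\<^sup>-\<^sup>1\<close> would send all proper iterates of \<open>y\<close>, hence
  also \<open>y\<close>, into \<open>span S\<close>, against the choice of \<open>N\<close>.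
\<close>
lemma eventually_zero_in_span_of_iterates:
  assumes T: "T \<in> lin_maps K V V" and S: "S \<subseteq> carrier V" and inv: "\<And>s. s \<in> S \<Longrightarrow> T s \<in> span S"
    and y: "y \<in> eventual_kernel V T" "y \<in> span (S \<union> (\<lambda>i. (T ^^ Suc i) y) ` UNIV)"
  shows "y \<in> span S"
proof -
  have yV: "y \<in> carrier V" and "\<exists>N. (T ^^ N) y \<in> span S"
    using y(1) span_zero by (auto simp: eventual_kernel_def) metis
  define N where "N = (LEAST N. (T ^^ N) y \<in> span S)"
  have N: "(T ^^ N) y \<in> span S"
    unfolding N_def by (rule LeastI_ex) fact
  have least: "N \<le> M" if "(T ^^ M) y \<in> span S" for M
    unfolding N_def using that by (rule Least_le)
  have sub: "submodule K (span S) V" by (rule is_module[OF span_is_subspace[OF S]])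
  note span_inv = span_invariant[OF T S inv]
  show ?thesis
  proof (cases N)
    case (Suc M)
    have "(T ^^ M) ((T ^^ Suc i) y) \<in> span S" for i
    proof -
      have "(T ^^ M) ((T ^^ Suc i) y) = (T ^^ (M + Suc i)) y" by (simp only: funpow_add comp_apply)
      also have "M + Suc i = i + N" using Suc by simp
      also have "(T ^^ (i + N)) y = (T ^^ i) ((T ^^ N) y)" by (simp only: funpow_add comp_apply)
      finally show ?thesis using span_inv N by simp
    qed
    then have "S \<union> (\<lambda>i. (T ^^ Suc i) y) ` UNIV \<subseteq> {v \<in> carrier V. (T ^^ M) v \<in> span S}"
      using S span_inv in_own_span[OF S] yV funpow_lin_map(1)[OF T] by blast
    then have "span (S \<union> (\<lambda>i. (T ^^ Suc i) y) ` UNIV) \<subseteq> {v \<in> carrier V. (T ^^ M) v \<in> span S}"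
      using span_zero funpow_lin_map(2-4)[OF T] submodule.m_closed[OF sub] submodule.smult_closed[OF sub]
      by (intro span_subset_closed) auto
    with y(2) have "N \<le> M" by (intro least) blast
    with Suc show ?thesis by simp
  qed (use N in simp)
qed

text \<open>
  The index \<open>j\<close> is the last one for which \<open>w\<close> still lies in the span of \<open>S\<close> and
  \<open>y j, \<dots>, y (k - 1)\<close>. The coefficient of \<open>y j\<close> is then not zero, and the relation
  can be solved for \<open>y j\<close>.
\<close>
lemma lin_indpt_chain_exchange:
  assumes "S \<union> y ` {..<k} \<subseteq> carrier V" "lin_indpt (S \<union> y ` {..<k})"
    and w: "w \<in> span (S \<union> y ` {..<k})" "w \<notin> span S"
  obtains j where "j < k" "y j \<in> span (insert w (S \<union> y ` {Suc j..<k}))"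
proof -
  let ?E = "\<lambda>j. S \<union> y ` {j..<k}"
  have "\<exists>j<k. (\<forall>i\<le>j. \<not> w \<notin> span (?E i)) \<and> w \<notin> span (?E (Suc j))"
    using w by (intro ex_least_nat_less) (auto simp: atLeast0LessThan)
  then obtain j where j: "j < k" "w \<in> span (?E j)" "w \<notin> span (?E (Suc j))" by blast
  have "{j..<k} = insert j {Suc j..<k}" using j(1) by auto
  then have E: "?E j = insert (y j) (?E (Suc j))" by simp
  have indep: "lin_indpt (?E (Suc j))" by (rule subset_li_is_li[OF assms(2)]) auto
  have V: "?E (Suc j) \<subseteq> carrier V" "y j \<in> carrier V" "w \<in> carrier V"
    using assms(1) j(1) w(1) span_is_subset2[OF assms(1)] by auto
  have "y j \<in> span (insert w (?E (Suc j)))"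
  proof (rule ccontr)
    assume y: "y j \<notin> span (insert w (?E (Suc j)))"
    have w': "lin_indpt (insert w (?E (Suc j)))" "w \<notin> ?E (Suc j)"
      using insert_lin_indpt_iff[OF V(1) indep V(3)] j(3) by auto
    have yw: "y j \<notin> insert w (?E (Suc j))" "lin_indpt (insert (y j) (insert w (?E (Suc j))))"
      using insert_lin_indpt_iff[OF _ w'(1) V(2)] V y by auto
    then have "w \<notin> insert (y j) (?E (Suc j))" "lin_indpt (insert w (?E j))"
      using w' E by (auto simp: insert_commute)
    moreover from this(2) have "lin_indpt (?E j)" by (rule subset_li_is_li) auto
    ultimately have "w \<notin> span (?E j)"
      using insert_lin_indpt_iff[of "?E j" w] V E by simp
    with j(2) show False by simp
  qed
  with j(1) show ?thesis by (rule that)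
qed

text \<open>
  For a nilpotent map, a chain \<open>y 0 \<mapsto> y 1 \<mapsto> \<dots>\<close> that is independent modulo \<open>span S\<close>
  and whose next value \<open>w\<close> is dependent on what came before must in fact end in
  \<open>span S\<close>: a relation involving the chain could be solved for some \<open>y j\<close> in terms of
  \<open>S\<close> and later members of the chain, which are iterates of \<open>y j\<close>.
\<close>
lemma nilpotent_chain_end_in_span:
  assumes T: "T \<in> lin_maps K V V" and nil: "carrier V \<subseteq> eventual_kernel V T"
    and S: "S \<subseteq> carrier V" and inv: "\<And>s. s \<in> S \<Longrightarrow> T s \<in> span S"
    and y: "y ` {..<k} \<subseteq> carrier V" "S \<inter> y ` {..<k} = {}" "inj_on y {..<k}" "lin_indpt (S \<union> y ` {..<k})"
    and step: "\<And>i. i < k \<Longrightarrow> T (y i) = (y(k := w)) (Suc i)"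
    and w: "w \<in> span (S \<union> y ` {..<k})"
  shows "w \<in> span S"
proof (rule ccontr)
  assume "w \<notin> span S"
  then obtain j where j: "j < k" "y j \<in> span (insert w (S \<union> y ` {Suc j..<k}))"
    using lin_indpt_chain_exchange[of S y k w] S y w by blast
  have iter: "(T ^^ i) (y j) = (y(k := w)) (j + i)" if "j + i \<le> k" for i
    using that
  proof (induction i)
    case (Suc i)
    then have "T ((y(k := w)) (j + i)) = (y(k := w)) (Suc (j + i))" using step[of "j + i"] by simp
    with Suc show ?case by simp
  qed (use j(1) in simp)
  have "v \<in> (\<lambda>i. (T ^^ Suc i) (y j)) ` UNIV" if v: "v \<in> insert w (y ` {Suc j..<k})" for v
  proof -
    have "\<exists>i. Suc j \<le> i \<and> i \<le> k \<and> v = (y(k := w)) i"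
    proof (cases "v = w")
      case True
      then show ?thesis using j(1) by (intro exI[of _ k]) simp
    next
      case False
      then obtain i where "i \<in> {Suc j..<k}" "v = y i" using v by blast
      then show ?thesis by (intro exI[of _ i]) simp
    qed
    then obtain i where i: "Suc j \<le> i" "i \<le> k" "v = (y(k := w)) i" by blast
    then have "v = (T ^^ Suc (i - Suc j)) (y j)" using iter[of "Suc (i - Suc j)"] by simp
    then show ?thesis by blast
  qed
  then have "insert w (S \<union> y ` {Suc j..<k}) \<subseteq> S \<union> (\<lambda>i. (T ^^ Suc i) (y j)) ` UNIV" by blast
  with j(2) have "y j \<in> span (S \<union> (\<lambda>i. (T ^^ Suc i) (y j)) ` UNIV)" using span_mono by blast
  then have "y j \<in> span S"
    using nil y(1) j(1) by (intro eventually_zero_in_span_of_iterates[OF T S inv]) auto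
  moreover have "lin_indpt S" "lin_indpt (insert (y j) S)"
    by (rule subset_li_is_li[OF y(4)]; use j(1) in auto)+
  moreover have "y j \<in> carrier V" "y j \<notin> S" using y j(1) by auto
  ultimately show False using insert_lin_indpt_iff[OF S] by blast
qed

end

section \<open>Counting nilpotent endomorphisms\<close>

text \<open>
  The endomorphisms about which the following is known: the values \<open>\<phi>\<close> on \<open>S\<close>,
  and that \<open>y 0 \<mapsto> y 1 \<mapsto> \<dots> \<mapsto> y (k - 1)\<close>. The value at the last vector of this chain is left
  open, and for \<open>k = 0\<close> there is no chain.
\<close>
definition chain_maps ::
  "('a, 'r) ring_scheme \<Rightarrow> ('a, 'v, 's) module_scheme \<Rightarrow> 'v set \<Rightarrow> ('v \<Rightarrow> 'v) \<Rightarrow> nat \<Rightarrow> (nat \<Rightarrow> 'v) \<Rightarrow> ('v \<Rightarrow> 'v) set"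
  where "chain_maps K V S \<phi> k y =
    {T \<in> lin_maps K V V. (\<forall>s\<in>S. T s = \<phi> s) \<and> (\<forall>i. Suc i < k \<longrightarrow> T (y i) = y (Suc i))}"

definition nilpotent_maps ::
  "('a, 'r) ring_scheme \<Rightarrow> ('a, 'v, 's) module_scheme \<Rightarrow> ('v \<Rightarrow> 'v) set"
  where "nilpotent_maps K V = {T \<in> lin_maps K V V. nilpotent_on V T}"

lemma card_eq_sum_fibres:
  assumes "finite A" "finite B" "f ` A \<subseteq> B"
  shows "card A = (\<Sum>b\<in>B. card {a \<in> A. f a = b})"
  using sum.group[OF assms, of "\<lambda>_. 1::nat"] by simp

context vectorspace
begin

text \<open>
  An endomorphism is revealed one value at a time. Suppose that its values on \<open>S\<close> are known, that
  they make \<open>span S\<close> invariant and the restriction to it nilpotent, and that moreover the chain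
  \<open>y 0, \<dots>, y (k - 1)\<close> of iterates, independent modulo \<open>span S\<close>, is known. Writing \<open>n\<close>
  for the dimension and \<open>s = card S\<close>, the claim is that a fraction \<open>q\<^sup>-\<^sup>(\<^sup>n\<^sup>-\<^sup>s\<^sup>)\<close> of
  the endomorphisms compatible with this knowledge is nilpotent, whatever the chain.

  The next value \<open>w = T (y (k - 1))\<close> is equally likely to be any of the \<open>q\<^sup>n\<close> vectors. If
  it is independent of \<open>S\<close> and the chain, the chain becomes longer and the fraction is the
  claimed one by induction. If it lies in \<open>span S\<close>, which happens for \<open>q\<^sup>s\<close> of the
  \<open>q\<^sup>s\<^sup>+\<^sup>k\<close> dependent values, then \<open>S\<close> and the chain together span an invariant
  subspace with nilpotent restriction, and by induction the fraction is \<open>q\<^sup>k\<close> times the claimed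
  one. For the other dependent values no compatible map is nilpotent. So the dependent values have
  the claimed fraction on average as well. If there is no chain, an arbitrary vector outside
  \<open>span S\<close> starts one; if there is no such vector, then the map is determined and nilpotent.
\<close>
theorem card_chain_maps_nilpotent:
  assumes fd: "fin_dim" and finK: "finite (carrier K)"
    and "S \<subseteq> carrier V" "y ` {..<k} \<subseteq> carrier V"
    and "S \<inter> y ` {..<k} = {}" "inj_on y {..<k}" "lin_indpt (S \<union> y ` {..<k})"
    and "\<And>s. s \<in> S \<Longrightarrow> \<phi> s \<in> span S"
    and "\<And>T. T \<in> lin_maps K V V \<Longrightarrow> \<forall>s\<in>S. T s = \<phi> s \<Longrightarrow> S \<subseteq> eventual_kernel V T"
  shows "card (chain_maps K V S \<phi> k y)
    = card (carrier K) ^ (dim - card S) * card (chain_maps K V S \<phi> k y \<inter> nilpotent_maps K V)"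
  using assms(3-)
proof (induction "2 * (dim - card S - k) + (if k = 0 then 0 else 1)" arbitrary: S \<phi> k y rule: less_induct)
  \<comment> \<open>Absorbing the chain into \<open>S\<close> leaves the number of unknown directions unchanged; the
    last summand of the measure makes this step descend.\<close>
  case less
  note S = less.prems(1) and Y = less.prems(2) and disj = less.prems(3) and inj = less.prems(4)
    and indep = less.prems(5) and inv = less.prems(6) and killed = less.prems(7)
  let ?q = "card (carrier K)" and ?N = "nilpotent_maps K V" and ?Y = "y ` {..<k}"
  have finV: "finite (carrier V)" by (rule finite_carrier[OF fd finK])
  have finL: "finite (lin_maps K V V)" by (rule finite_lin_maps[OF finV finV])
  have indepS: "lin_indpt S" by (rule subset_li_is_li[OF indep]) auto
  have finS: "finite S" by (rule li_le_dim(1)[OF fd S indepS])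
  have SY: "S \<union> ?Y \<subseteq> carrier V" "finite (S \<union> ?Y)" using S Y finS by auto
  have card_SY: "card (S \<union> ?Y) = card S + k"
    using disj inj finS by (simp add: card_Un_disjoint card_image)
  have le_dim: "card S + k \<le> dim" using li_le_dim(2)[OF fd SY(1) indep] card_SY by simp
  show ?case
  proof (cases "k = 0")
    case k: True
    show ?thesis
    proof (cases "span S = carrier V")
      case True
      have "T \<in> ?N" if "T \<in> chain_maps K V S \<phi> k y" for T
      proof -
        have T: "T \<in> lin_maps K V V" "\<forall>s\<in>S. T s = \<phi> s" using that by (auto simp: chain_maps_def)
        have "carrier V \<subseteq> eventual_kernel V T"
          using span_subset_eventual_kernel[OF T(1) killed[OF T]] True by simp
        then show ?thesis using T(1) nilpotent_on_iff_eventual_kernel[OF T(1) finV] by (simp add: nilpotent_maps_def)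
      qed
      then have "chain_maps K V S \<phi> k y \<inter> ?N = chain_maps K V S \<phi> k y" by blast
      moreover have "dim = card S"
        using True indepS S finS by (intro dim_basis) (auto simp: basis_def)
      ultimately show ?thesis by simp
    next
      case False
      then obtain x where x: "x \<in> carrier V" "x \<notin> span S" using span_is_subset2[OF S] by blast
      then have x': "x \<notin> S" "lin_indpt (insert x S)" using insert_lin_indpt_iff[OF S indepS] by auto
      have "card S < dim"
        using lin_indpt_spans_if_maximal[OF fd S indepS] False by linarith
      have "card (chain_maps K V S \<phi> 1 (\<lambda>_. x))
        = ?q ^ (dim - card S) * card (chain_maps K V S \<phi> 1 (\<lambda>_. x) \<inter> ?N)"
      proof (rule less.hyps)
        show "2 * (dim - card S - 1) + (if (1::nat) = 0 then 0 else 1) < 2 * (dim - card S - k) + (if k = 0 then 0 else 1)"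
          using k \<open>card S < dim\<close> by simp
      qed (use S x x' inv killed in \<open>auto simp: lessThan_Suc\<close>)
      moreover have "chain_maps K V S \<phi> 1 (\<lambda>_. x) = chain_maps K V S \<phi> k y"
        by (auto simp: chain_maps_def k)
      ultimately show ?thesis by simp
    qed
  next
    case False
    define l where "l = k - 1"
    have k: "k = Suc l" using False by (simp add: l_def)
    have yl: "y l \<in> carrier V" using Y k by auto
    let ?C = "chain_maps K V S \<phi> k y"
    define D where "D w = {T \<in> ?C. T (y l) = w}" for w
    define \<psi> where "\<psi> w v = (if v \<in> S then \<phi> v else (y(k := w)) (Suc (the_inv_into {..<k} y v)))" for w v
    have \<psi>S: "\<psi> w s = \<phi> s" if "s \<in> S" for w s using that by (simp add: \<psi>_def)
    have \<psi>Y: "\<psi> w (y i) = (y(k := w)) (Suc i)" if "i < k" for w i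
      using that disj the_inv_into_f_f[OF inj] by (auto simp: \<psi>_def)
    \<comment> \<open>Fixing the value \<open>w\<close> at the end of the chain can be seen as a longer chain or as a larger set
      of prescribed values; these two views feed the two cases of the induction.\<close>
    have D_chain: "D w = chain_maps K V S \<phi> (Suc k) (y(k := w))" for w
      unfolding D_def chain_maps_def k by (auto simp: less_Suc_eq)
    have D_closed: "D w = chain_maps K V (S \<union> ?Y) (\<psi> w) 0 y" for w
      unfolding D_chain chain_maps_def using \<psi>S \<psi>Y by auto
    have \<psi>V: "\<psi> w v \<in> carrier V" if "v \<in> S \<union> ?Y" "w \<in> carrier V" for v w
    proof (cases "v \<in> S")
      case True
      then show ?thesis using inv span_is_subset2[OF S] \<psi>S by auto
    next
      case False
      then obtain i where "i < k" "v = y i" using \<open>v \<in> S \<union> ?Y\<close> by auto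
      then show ?thesis using \<psi>Y Y \<open>w \<in> carrier V\<close> by auto
    qed
    define A where "A = card (carrier V) ^ (dim - card S - k)"
    have card_D: "card (D w) = A" if "w \<in> carrier V" for w
    proof -
      have "D w = {T \<in> lin_maps K V V. \<forall>s\<in>S \<union> ?Y. T s = \<psi> w s}"
        by (simp add: D_closed chain_maps_def)
      then show ?thesis
        using card_lin_maps_prescribed[OF vectorspace_axioms vectorspace_axioms fd SY(1) indep \<psi>V] that
        by (simp add: card_SY A_def)
    qed
    have grow: "?q ^ (dim - card S) * card (D w \<inter> ?N) = A" if w: "w \<in> carrier V - span (S \<union> ?Y)" for w
    proof -
      have w': "w \<notin> S \<union> ?Y" "lin_indpt (insert w (S \<union> ?Y))"
        using insert_lin_indpt_iff[OF SY(1) indep] w by auto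
      have img: "(y(k := w)) ` {..<Suc k} = insert w ?Y" by (auto simp: lessThan_Suc)
      have "card S + Suc k \<le> dim"
        using li_le_dim(2)[OF fd _ w'(2)] w w'(1) SY card_SY by auto
      have "card (chain_maps K V S \<phi> (Suc k) (y(k := w)))
        = ?q ^ (dim - card S) * card (chain_maps K V S \<phi> (Suc k) (y(k := w)) \<inter> ?N)"
      proof (rule less.hyps)
        show "2 * (dim - card S - Suc k) + (if Suc k = 0 then 0 else 1) < 2 * (dim - card S - k) + (if k = 0 then 0 else 1)"
          using k \<open>card S + Suc k \<le> dim\<close> by simp
        show "inj_on (y(k := w)) {..<Suc k}"
          using inj w'(1) by (auto simp: inj_on_def less_Suc_eq)
        show "(y(k := w)) ` {..<Suc k} \<subseteq> carrier V" "S \<inter> (y(k := w)) ` {..<Suc k} = {}"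
          "lin_indpt (S \<union> (y(k := w)) ` {..<Suc k})"
          unfolding img using Y w w' disj by auto
      qed (use S inv killed in auto)
      then show ?thesis using card_D[of w] w by (simp add: D_chain)
    qed
    have closed: "?q ^ (dim - card S - k) * card (D w \<inter> ?N) = A" if w: "w \<in> span S" for w
    proof -
      have wV: "w \<in> carrier V" using w span_is_subset2[OF S] by blast
      have spanS: "span S \<subseteq> span (S \<union> ?Y)" by (rule span_mono) simp
      have "card (chain_maps K V (S \<union> ?Y) (\<psi> w) 0 y)
        = ?q ^ (dim - card (S \<union> ?Y)) * card (chain_maps K V (S \<union> ?Y) (\<psi> w) 0 y \<inter> ?N)"
      proof (rule less.hyps)
        show "2 * (dim - card (S \<union> ?Y) - 0) + (if (0::nat) = 0 then 0 else 1) < 2 * (dim - card S - k) + (if k = 0 then 0 else 1)"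
          using k card_SY by simp
        show "\<psi> w s \<in> span (S \<union> ?Y)" if s: "s \<in> S \<union> ?Y" for s
        proof (cases "s \<in> S")
          case True
          then show ?thesis using inv spanS \<psi>S by auto
        next
          case False
          then obtain i where i: "i < k" "s = y i" using s by auto
          then show ?thesis
            using \<psi>Y w spanS in_own_span[OF SY(1)] by (cases "Suc i = k") auto
        qed
        show "S \<union> ?Y \<subseteq> eventual_kernel V T" if T: "T \<in> lin_maps K V V" and eq: "\<forall>s\<in>S \<union> ?Y. T s = \<psi> w s" for T
        proof -
          have S_ek: "S \<subseteq> eventual_kernel V T" using killed[OF T] eq \<psi>S by auto
          have shift: "T (y i) = (y(k := w)) (Suc i)" if "i < k" for i
            using eq \<psi>Y that by auto
          have pull: "u \<in> eventual_kernel V T" if u: "u \<in> carrier V" "T u \<in> eventual_kernel V T" for u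
          proof -
            obtain N where "(T ^^ N) (T u) = \<zero>\<^bsub>V\<^esub>" using u(2) by (auto simp: eventual_kernel_def)
            then have "(T ^^ Suc N) u = \<zero>\<^bsub>V\<^esub>" by (simp add: funpow_swap1)
            then show ?thesis using u(1) unfolding eventual_kernel_def by blast
          qed
          have ek: "(y(k := w)) i \<in> eventual_kernel V T" if "i \<le> k" for i
            using that
          proof (induction rule: inc_induct)
            case base
            show ?case using w span_subset_eventual_kernel[OF T S_ek] by auto
          next
            case (step i)
            then show ?case using Y pull[of "y i"] shift[of i] by auto
          qed
          have "y i \<in> eventual_kernel V T" if "i < k" for i
            using ek[of i] that by simp
          then show ?thesis using S_ek by auto
        qed
      qed (use SY indep in auto)
      then show ?thesis using card_D[OF wV] by (simp add: D_closed card_SY)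
    qed
    have stuck: "D w \<inter> ?N = {}" if w: "w \<in> span (S \<union> ?Y) - span S" for w
    proof -
      have False if "T \<in> D w" "T \<in> ?N" for T
      proof -
        have T: "T \<in> lin_maps K V V" "\<forall>s\<in>S. T s = \<phi> s" "\<And>i. i < k \<Longrightarrow> T (y i) = (y(k := w)) (Suc i)"
          using that(1) unfolding D_chain chain_maps_def by auto
        have "carrier V \<subseteq> eventual_kernel V T"
          using that(2) nilpotent_on_iff_eventual_kernel[OF T(1) finV] by (simp add: nilpotent_maps_def)
        then have "w \<in> span S"
          using T inv w by - (rule nilpotent_chain_end_in_span[OF T(1) _ S _ Y disj inj indep], auto)
        with w show False by simp
      qed
      then show ?thesis by blast
    qed
    have finC: "finite ?C" using finL by (rule finite_subset[rotated]) (auto simp: chain_maps_def)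
    have sub: "span S \<subseteq> span (S \<union> ?Y)" "span (S \<union> ?Y) \<subseteq> carrier V"
      using span_mono[of S "S \<union> ?Y"] span_is_subset2[OF SY(1)] by auto
    have img: "(\<lambda>T. T (y l)) ` ?C \<subseteq> carrier V"
      using lin_mapsD(1) yl by (fastforce simp: chain_maps_def)
    have "card (?C \<inter> ?N) = (\<Sum>w\<in>carrier V. card (D w \<inter> ?N))"
    proof -
      have "{T \<in> ?C \<inter> ?N. T (y l) = w} = D w \<inter> ?N" for w by (auto simp: D_def)
      then show ?thesis
        using card_eq_sum_fibres[of "?C \<inter> ?N" "carrier V" "\<lambda>T. T (y l)"] finC finV img by force
    qed
    also have "\<dots> = (\<Sum>w\<in>carrier V - span (S \<union> ?Y). card (D w \<inter> ?N)) + (\<Sum>w\<in>span (S \<union> ?Y). card (D w \<inter> ?N))"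
      by (rule sum.subset_diff[OF sub(2) finV])
    also have "(\<Sum>w\<in>span (S \<union> ?Y). card (D w \<inter> ?N)) = (\<Sum>w\<in>span S. card (D w \<inter> ?N))"
      using finite_subset[OF sub(2) finV] sub(1) stuck by (intro sum.mono_neutral_right) auto
    \<comment> \<open>With \<open>s = card S\<close>, the two sums become \<open>q\<^sup>n - q\<^sup>s\<^sup>+\<^sup>k\<close> and \<open>q\<^sup>s \<cdot> q\<^sup>k\<close> times the
      common size \<open>A\<close> of the fibres, which add up to the number of all compatible maps.\<close>
    finally have "?q ^ (dim - card S) * card (?C \<inter> ?N)
      = (\<Sum>w\<in>carrier V - span (S \<union> ?Y). ?q ^ (dim - card S) * card (D w \<inter> ?N))
        + (\<Sum>w\<in>span S. ?q ^ (dim - card S) * card (D w \<inter> ?N))"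
      by (simp add: algebra_simps sum_distrib_left)
    also have "(\<Sum>w\<in>carrier V - span (S \<union> ?Y). ?q ^ (dim - card S) * card (D w \<inter> ?N))
      = (card (carrier V) - ?q ^ (card S + k)) * A"
      using grow card_span_lin_indpt[OF SY(2,1) indep] finite_subset[OF sub(2) finV] sub(2)
      by (simp add: card_SY card_Diff_subset)
    also have "(\<Sum>w\<in>span S. ?q ^ (dim - card S) * card (D w \<inter> ?N)) = (\<Sum>w\<in>span S. ?q ^ k * A)"
    proof (rule sum.cong[OF refl])
      fix w assume "w \<in> span S"
      have "?q ^ (dim - card S) = ?q ^ k * ?q ^ (dim - card S - k)"
        using le_dim by (simp flip: power_add)
      then show "?q ^ (dim - card S) * card (D w \<inter> ?N) = ?q ^ k * A"
        using closed[OF \<open>w \<in> span S\<close>] by (simp add: mult.assoc)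
    qed
    also have "\<dots> = ?q ^ (card S + k) * A"
      using card_span_lin_indpt[OF finS S indepS] by (simp add: power_add)
    also have "(card (carrier V) - ?q ^ (card S + k)) * A + ?q ^ (card S + k) * A = card (carrier V) * A"
    proof -
      have "?q ^ (card S + k) \<le> card (carrier V)"
        using card_mono[OF finV sub(2)] card_span_lin_indpt[OF SY(2,1) indep] card_SY by simp
      then show ?thesis by (simp flip: add_mult_distrib)
    qed
    also have "\<dots> = (\<Sum>w\<in>carrier V. card (D w))" using card_D by simp
    also have "\<dots> = card ?C"
      using card_eq_sum_fibres[OF finC finV img] by (simp add: D_def)
    finally show ?thesis by simp
  qed
qed

text \<open>
  The theorem of Fine and Herstein: knowing nothing, the fraction of nilpotent endomorphisms is
  \<open>q\<^sup>-\<^sup>n\<close>.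
\<close>
corollary card_nilpotent_maps:
  assumes "fin_dim" "finite (carrier K)"
  shows "card (carrier K) ^ dim * card (nilpotent_maps K V) = card (lin_maps K V V)"
proof -
  have "lin_indpt {}" by (auto simp: lin_dep_def)
  then have "card (chain_maps K V {} id 0 (\<lambda>_. \<zero>\<^bsub>V\<^esub>))
    = card (carrier K) ^ (dim - card ({}::'c set)) * card (chain_maps K V {} id 0 (\<lambda>_. \<zero>\<^bsub>V\<^esub>) \<inter> nilpotent_maps K V)"
    by (intro card_chain_maps_nilpotent[OF assms]) auto
  moreover have "chain_maps K V {} id 0 (\<lambda>_. \<zero>\<^bsub>V\<^esub>) = lin_maps K V V" by (simp add: chain_maps_def)
  moreover have "lin_maps K V V \<inter> nilpotent_maps K V = nilpotent_maps K V" by (auto simp: nilpotent_maps_def)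
  ultimately show ?thesis by simp
qed

end

section \<open>Pairs of maps between two spaces\<close>
lemma compose_lin_maps:
  assumes "vectorspace K U" and f: "f \<in> lin_maps K U V" and g: "g \<in> lin_maps K V W"
  shows "compose (carrier U) g f \<in> lin_maps K U W"
proof -
  interpret U: vectorspace K U by fact
  show ?thesis
    unfolding lin_maps_def LinearCombinations.module_hom_def
    by (auto simp: compose_def lin_mapsD[OF f] lin_mapsD[OF g])
qed

lemma nilpotent_pair_iff:
  assumes f: "f \<in> lin_maps K V W" and g: "g \<in> lin_maps K W V"
  shows "nilpotent_pair V f g \<longleftrightarrow> nilpotent_on V (compose (carrier V) g f)"
proof -
  have "((g \<circ> f) ^^ k) v = (compose (carrier V) g f ^^ k) v \<and> ((g \<circ> f) ^^ k) v \<in> carrier V"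
    if "v \<in> carrier V" for v k
    using that by (induction k) (auto simp: compose_def intro: lin_mapsD(1)[OF f] lin_mapsD(1)[OF g])
  then show ?thesis by (simp add: nilpotent_pair_def nilpotent_on_def)
qed

lemma lin_maps_linear_map:
  assumes "vectorspace K V" "vectorspace K W" "f \<in> lin_maps K V W"
  shows "linear_map K V W f"
proof -
  interpret V: vectorspace K V by fact
  interpret W: vectorspace K W by fact
  show ?thesis using assms(3) by unfold_locales (auto simp: lin_maps_def)
qed

lemma lin_indpt_inj_image:
  assumes "vectorspace K V" "vectorspace K W" "f \<in> lin_maps K V W" "inj_on f (carrier V)"
    and B: "finite B" "B \<subseteq> carrier V" "\<not> LinearCombinations.module.lin_dep K V B"
  shows "\<not> LinearCombinations.module.lin_dep K W (f ` B)"
proof -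
  interpret V: vectorspace K V by fact
  interpret W: vectorspace K W by fact
  interpret linear_map K V W f by (rule lin_maps_linear_map) fact+
  show ?thesis
  proof (rule W.finite_lin_indpt2)
    show "finite (f ` B)" "f ` B \<subseteq> carrier W" using B by auto
  next
    fix a assume a: "a \<in> f ` B \<rightarrow> carrier K" "W.lincomb a (f ` B) = \<zero>\<^bsub>W\<^esub>"
    have coeff: "a \<circ> f \<in> B \<rightarrow> carrier K" using a(1) by auto
    have "f (V.lincomb (a \<circ> f) B) = f \<zero>\<^bsub>V\<^esub>"
      using lincomb_linear_image[OF assms(4) B(2) a(1) B(1)] a(2) by simp
    then have "V.lincomb (a \<circ> f) B = \<zero>\<^bsub>V\<^esub>"
      by (rule inj_onD[OF assms(4)]) (use B(2) coeff in auto)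
    then show "\<forall>v\<in>f ` B. a v = \<zero>\<^bsub>K\<^esub>"
      using V.not_lindepD[OF B(3,1) subset_refl coeff] by auto
  qed
qed

text \<open>
  Prescribing \<open>g \<circ> f\<close> for an injective \<open>f\<close> is the same as prescribing \<open>g\<close> on the
  image of a basis under \<open>f\<close>, which is an independent set. All fibres of \<open>g \<mapsto> g \<circ> f\<close>
  therefore have the same size, so that \<open>g \<circ> f\<close> is uniformly distributed when \<open>g\<close> is.
\<close>
lemma card_compose_fibre:
  assumes V: "vectorspace K V" "vectorspace.fin_dim K V" and W: "vectorspace K W" "vectorspace.fin_dim K W"
    and f: "f \<in> lin_maps K V W" "inj_on f (carrier V)" and h: "h \<in> lin_maps K V V"
  shows "card {g \<in> lin_maps K W V. compose (carrier V) g f = h}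
    = card (carrier V) ^ (vectorspace.dim K W - vectorspace.dim K V)"
proof -
  interpret V: vectorspace K V by fact
  interpret W: vectorspace K W by fact
  interpret linear_map K V W f by (rule lin_maps_linear_map[OF V(1) W(1) f(1)])
  obtain B where B: "finite B" "V.basis B" using V.finite_basis_exists[OF V(2)] by blast
  then have BV: "B \<subseteq> carrier V" "V.lin_indpt B" by (auto simp: V.basis_def)
  define \<phi> where "\<phi> w = h (the_inv_into B f w)" for w
  have injB: "inj_on f B" using f(2) BV(1) by (rule inj_on_subset)
  have \<phi>: "\<phi> (f b) = h b" if "b \<in> B" for b using that by (simp add: \<phi>_def the_inv_into_f_f[OF injB])
  have "compose (carrier V) g f = h \<longleftrightarrow> (\<forall>w\<in>f ` B. g w = \<phi> w)" if g: "g \<in> lin_maps K W V" for g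
  proof
    assume "compose (carrier V) g f = h"
    then show "\<forall>w\<in>f ` B. g w = \<phi> w" using BV(1) \<phi> by (auto simp: compose_def)
  next
    assume eq: "\<forall>w\<in>f ` B. g w = \<phi> w"
    show "compose (carrier V) g f = h"
      by (rule lin_maps_eqI[OF V(1) V(1) compose_lin_maps[OF V(1) f(1) g] h B(2)])
        (use eq \<phi> BV(1) in \<open>auto simp: compose_def\<close>)
  qed
  then have "{g \<in> lin_maps K W V. compose (carrier V) g f = h} = {g \<in> lin_maps K W V. \<forall>w\<in>f ` B. g w = \<phi> w}"
    by blast
  moreover have "card \<dots> = card (carrier V) ^ (W.dim - card (f ` B))"
  proof (rule card_lin_maps_prescribed[OF W(1) V(1) W(2)])
    show "f ` B \<subseteq> carrier W" using BV(1) by auto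
    show "W.lin_indpt (f ` B)" by (rule lin_indpt_inj_image[OF V(1) W(1) f B(1) BV])
    show "\<phi> w \<in> carrier V" if "w \<in> f ` B" for w
      using that \<phi> lin_mapsD(1)[OF h] BV(1) by auto
  qed
  ultimately show ?thesis using injB B V.dim_basis by (simp add: card_image)
qed

text \<open>
  A union bound: a map that is not injective kills some nonzero vector, and the maps that kill a
  given nonzero vector are a fraction \<open>1 / card (carrier W)\<close> of all maps.
\<close>
lemma card_non_injective_le:
  assumes V: "vectorspace K V" "vectorspace.fin_dim K V" and W: "vectorspace K W" "vectorspace.fin_dim K W"
    and finK: "finite (carrier K)"
  shows "card {f \<in> lin_maps K V W. \<not> inj_on f (carrier V)} * card (carrier W)
    \<le> card (carrier V) * card (lin_maps K V W)"
proof -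
  interpret V: vectorspace K V by fact
  interpret W: vectorspace K W by fact
  have finV: "finite (carrier V)" and finW: "finite (carrier W)"
    using V.finite_carrier W.finite_carrier V W finK by auto
  define Z where "Z v = {f \<in> lin_maps K V W. f v = \<zero>\<^bsub>W\<^esub>}" for v
  let ?V' = "carrier V - {\<zero>\<^bsub>V\<^esub>}"
  have card_Z: "card (Z v) * card (carrier W) = card (lin_maps K V W)" if v: "v \<in> ?V'" for v
  proof -
    have "V.lin_indpt {}" by (auto simp: V.lin_dep_def)
    then have indep: "V.lin_indpt {v}"
      using V.insert_lin_indpt_iff[of "{}" v] v by (simp add: V.span_empty)
    have "card (Z v) = card (carrier W) ^ (V.dim - 1)"
      using card_lin_maps_prescribed[OF V(1) W(1) V(2) _ indep, of "\<lambda>_. \<zero>\<^bsub>W\<^esub>"] v by (simp add: Z_def)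
    moreover have "1 \<le> V.dim" using V.li_le_dim(2)[OF V(2) _ indep] v by simp
    ultimately show ?thesis
      using card_lin_maps[OF V(1) W(1) V(2)] by (simp flip: power_Suc2)
  qed
  have "{f \<in> lin_maps K V W. \<not> inj_on f (carrier V)} \<subseteq> (\<Union>v\<in>?V'. Z v)"
  proof
    fix f assume "f \<in> {f \<in> lin_maps K V W. \<not> inj_on f (carrier V)}"
    then have f: "f \<in> lin_maps K V W" "\<not> inj_on f (carrier V)" by auto
    interpret linear_map K V W f by (rule lin_maps_linear_map[OF V(1) W(1) f(1)])
    have "ker \<noteq> {\<zero>\<^bsub>V\<^esub>}" using Ke0_imp_inj f(2) by auto
    then have "\<exists>v\<in>?V'. f v = \<zero>\<^bsub>W\<^esub>" by (auto simp: ker_def)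
    then show "f \<in> (\<Union>v\<in>?V'. Z v)" using f(1) by (auto simp: Z_def)
  qed
  then have "card {f \<in> lin_maps K V W. \<not> inj_on f (carrier V)} \<le> card (\<Union>v\<in>?V'. Z v)"
    using finite_lin_maps[OF finV finW, of K] finV by (intro card_mono) (auto simp: Z_def)
  also have "\<dots> \<le> (\<Sum>v\<in>?V'. card (Z v))" using finV by (intro card_UN_le) auto
  finally have "card {f \<in> lin_maps K V W. \<not> inj_on f (carrier V)} * card (carrier W)
    \<le> (\<Sum>v\<in>?V'. card (Z v)) * card (carrier W)" by (rule mult_right_mono) simp
  also have "\<dots> = card ?V' * card (lin_maps K V W)" by (simp add: sum_distrib_right card_Z)
  also have "\<dots> \<le> card (carrier V) * card (lin_maps K V W)"
    using card_mono[OF finV, of ?V'] by (intro mult_right_mono) auto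
  finally show ?thesis .
qed

text \<open>
  For each injective \<open>f\<close>, the composition is a uniformly distributed endomorphism, which is
  nilpotent with probability \<open>1 / card (carrier V)\<close>.
\<close>
lemma card_injective_nilpotent_pairs:
  assumes V: "vectorspace K V" "vectorspace.fin_dim K V" and W: "vectorspace K W" "vectorspace.fin_dim K W"
    and finK: "finite (carrier K)" and le: "vectorspace.dim K V \<le> vectorspace.dim K W"
  shows "card {(f, g) \<in> lin_maps K V W \<times> lin_maps K W V. inj_on f (carrier V) \<and> nilpotent_pair V f g} * card (carrier V)
    = card {f \<in> lin_maps K V W. inj_on f (carrier V)} * card (lin_maps K W V)"
proof -
  interpret V: vectorspace K V by fact
  interpret W: vectorspace K W by fact
  have finV: "finite (carrier V)" and finW: "finite (carrier W)"
    using V.finite_carrier W.finite_carrier V W finK by auto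
  let ?I = "{f \<in> lin_maps K V W. inj_on f (carrier V)}" and ?N = "nilpotent_maps K V"
  let ?G = "\<lambda>f. {g \<in> lin_maps K W V. nilpotent_pair V f g}"
  have fin: "finite (lin_maps K V W)" "finite (lin_maps K W V)" "finite ?N"
    using finite_lin_maps[OF finV finW, of K] finite_lin_maps[OF finW finV, of K] finite_lin_maps[OF finV finV, of K]
    by (auto simp: nilpotent_maps_def)
  have "card (?G f) = card ?N * card (carrier V) ^ (W.dim - V.dim)" if f: "f \<in> ?I" for f
  proof -
    have "card (?G f) = (\<Sum>h\<in>?N. card {g \<in> ?G f. compose (carrier V) g f = h})"
      using fin f nilpotent_pair_iff[of f K V W] compose_lin_maps[OF V(1), of f W _ V]
      by (intro card_eq_sum_fibres) (auto simp: nilpotent_maps_def)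
    also have "\<dots> = (\<Sum>h\<in>?N. card (carrier V) ^ (W.dim - V.dim))"
    proof (rule sum.cong[OF refl])
      fix h assume h: "h \<in> ?N"
      have "{g \<in> ?G f. compose (carrier V) g f = h} = {g \<in> lin_maps K W V. compose (carrier V) g f = h}"
        using f h nilpotent_pair_iff[of f K V W] by (auto simp: nilpotent_maps_def)
      then show "card {g \<in> ?G f. compose (carrier V) g f = h} = card (carrier V) ^ (W.dim - V.dim)"
        using f h card_compose_fibre[OF V W] by (simp add: nilpotent_maps_def)
    qed
    finally show ?thesis by simp
  qed
  moreover have "{(f, g) \<in> lin_maps K V W \<times> lin_maps K W V. inj_on f (carrier V) \<and> nilpotent_pair V f g} = Sigma ?I ?G"
    by auto
  ultimately have pairs: "card {(f, g) \<in> lin_maps K V W \<times> lin_maps K W V. inj_on f (carrier V) \<and> nilpotent_pair V f g}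
      = card ?I * (card ?N * card (carrier V) ^ (W.dim - V.dim))"
    using fin by (simp add: card_SigmaI)
  have nil: "card ?N * card (carrier V) = card (carrier V) ^ V.dim"
  proof -
    obtain B where "finite B" "V.basis B" using V.finite_basis_exists[OF V(2)] by blast
    then have "card (carrier V) = card (carrier K) ^ V.dim"
      using V.card_carrier_eq V.dim_basis by simp
    then show ?thesis
      using V.card_nilpotent_maps[OF V(2) finK] card_lin_maps[OF V(1) V(1) V(2)] by (simp add: mult.commute)
  qed
  have total: "card (lin_maps K W V) = card (carrier V) ^ V.dim * card (carrier V) ^ (W.dim - V.dim)"
    using card_lin_maps[OF W(1) V(1) W(2)] le by (simp flip: power_add)
  show ?thesis unfolding pairs total nil[symmetric] by (simp add: mult_ac)
qed

text \<open>
  Conditioned on \<open>f\<close> being injective the probability is exactly \<open>1 / card (carrier V)\<close>, so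
  the deviation is at most the probability that \<open>f\<close> is not injective.
\<close>
lemma nilpotent_pair_prob_bound:
  assumes V: "vectorspace K V" "vectorspace.fin_dim K V" and W: "vectorspace K W" "vectorspace.fin_dim K W"
    and finK: "finite (carrier K)" and le: "vectorspace.dim K V \<le> vectorspace.dim K W"
  shows "\<bar>nilpotent_pair_prob K V W - 1 / card (carrier V)\<bar> \<le> card (carrier V) / card (carrier W)"
proof -
  interpret V: vectorspace K V by fact
  interpret W: vectorspace K W by fact
  have finV: "finite (carrier V)" and finW: "finite (carrier W)"
    using V.finite_carrier W.finite_carrier V W finK by auto
  have fin: "finite (lin_maps K V W)" "finite (lin_maps K W V)"
    using finite_lin_maps finV finW by auto
  define L M I where "L = card (lin_maps K V W)" and "M = card (lin_maps K W V)"
    and "I = card {f \<in> lin_maps K V W. inj_on f (carrier V)}"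
  define J where "J = card {f \<in> lin_maps K V W. \<not> inj_on f (carrier V)}"
  define v w where "v = card (carrier V)" and "w = card (carrier W)"
  let ?P = "\<lambda>Q. {(f, g) \<in> lin_maps K V W \<times> lin_maps K W V. Q f \<and> nilpotent_pair V f g}"
  define X Y where "X = card (?P (\<lambda>f. inj_on f (carrier V)))" and "Y = card (?P (\<lambda>f. \<not> inj_on f (carrier V)))"
  have "v > 0" "w > 0" using finV finW V.M.zero_closed W.M.zero_closed by (auto simp: v_def w_def card_gt_0_iff)
  then have pos: "L > 0" "M > 0" "v > 0" "w > 0"
    unfolding L_def M_def v_def w_def
    using card_lin_maps[OF V(1) W(1) V(2)] card_lin_maps[OF W(1) V(1) W(2)] by auto
  have X: "X * v = I * M"
    unfolding X_def v_def I_def M_def by (rule card_injective_nilpotent_pairs[OF V W finK le])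
  have J: "J * w \<le> v * L"
    unfolding J_def w_def v_def L_def by (rule card_non_injective_le[OF V W finK])
  have IJ: "I + J = L"
    unfolding I_def J_def L_def using fin
    by (subst card_Un_disjoint[symmetric]) (auto intro!: arg_cong[where f = card])
  have Y: "Y \<le> J * M"
    unfolding Y_def J_def M_def using fin
    by (subst card_cartesian_product[symmetric], intro card_mono) auto
  have "nilpotent_pair_prob K V W
    = card (lin_maps K V W \<times> lin_maps K W V \<inter> {(f, g). nilpotent_pair V f g}) / card (lin_maps K V W \<times> lin_maps K W V)"
    unfolding nilpotent_pair_prob_def
    using fin pos(1,2) by (subst measure_pmf_of_set) (auto simp: L_def M_def card_gt_0_iff)
  also have "lin_maps K V W \<times> lin_maps K W V \<inter> {(f, g). nilpotent_pair V f g}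
    = ?P (\<lambda>f. inj_on f (carrier V)) \<union> ?P (\<lambda>f. \<not> inj_on f (carrier V))" by auto
  also have "card \<dots> = X + Y"
    unfolding X_def Y_def using fin
    by (intro card_Un_disjoint) (auto intro: finite_subset[of _ "lin_maps K V W \<times> lin_maps K W V"])
  finally have P: "nilpotent_pair_prob K V W = (real X + real Y) / (real L * real M)"
    by (simp add: card_cartesian_product L_def M_def)
  have X': "real X / (real L * real M) = (1 - J / L) * (1 / v)"
  proof -
    have "real X * v = (real L - J) * M" using X IJ by (metis add_diff_cancel_right' of_nat_add of_nat_mult)
    then show ?thesis using pos by (simp add: field_simps)
  qed
  have Y': "0 \<le> real Y / (real L * real M)" "real Y / (real L * real M) \<le> J / L"
    using pos of_nat_mono[OF Y, where ?'a = real] by (simp_all add: field_simps)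
  have J': "0 \<le> J / real L * (1 / v)" "J / real L * (1 / v) \<le> J / real L" "J / real L \<le> v / w"
  proof -
    show "J / real L * (1 / v) \<le> J / real L" using pos by (intro mult_left_le) auto
    have "real (J * w) \<le> real (v * L)" using J by (rule of_nat_mono)
    then show "J / real L \<le> v / w" using pos by (simp add: field_simps)
  qed simp
  have "nilpotent_pair_prob K V W - 1 / v = real Y / (real L * real M) - J / real L * (1 / v)"
    unfolding P add_divide_distrib X' left_diff_distrib by simp
  then show ?thesis
    using Y' J' unfolding v_def[symmetric] w_def[symmetric] by linarith
qed

theorem theorem4p22:
  fixes K :: "('a, 'r) ring_scheme"
    and V :: "('a, 'v, 's) module_scheme"
    and W :: "nat \<Rightarrow> ('a, 'w, 't) module_scheme"
    and q m :: nat
  assumes "primepow q"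
    and "field K" and "finite (carrier K)" and "card (carrier K) = q"
    and "vectorspace K V" and "vectorspace.fin_dim K V" and "vectorspace.dim K V = m"
    and "\<And>n. vectorspace K (W n)"
    and "\<And>n. vectorspace.fin_dim K (W n)"
    and "\<And>n. vectorspace.dim K (W n) = n"
  shows "(\<lambda>n. nilpotent_pair_prob K V (W n)) \<longlonglongrightarrow> real q powi (- int m)"
proof -
  interpret V: vectorspace K V by fact
  have q: "q > 1" using assms(1) by (rule primepow_gt_Suc_0[unfolded One_nat_def[symmetric]])
  have card_V: "card (carrier V) = q ^ m"
    using V.finite_basis_exists[OF assms(6)] V.card_carrier_eq V.dim_basis assms(4,7) by metis
  have card_W: "card (carrier (W n)) = q ^ n" for n
  proof -
    interpret W: vectorspace K "W n" by fact
    show ?thesis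
      using W.finite_basis_exists[OF assms(9)] W.card_carrier_eq W.dim_basis assms(4,10) by metis
  qed
  have "(\<lambda>n. real q ^ m * inverse (real q ^ n)) \<longlonglongrightarrow> real q ^ m * 0"
    using q by (intro tendsto_mult_left LIMSEQ_inverse_realpow_zero) simp
  then have null: "(\<lambda>n. real q ^ m * inverse (real q ^ n)) \<longlonglongrightarrow> 0" by simp
  have "(\<lambda>n. nilpotent_pair_prob K V (W n) - 1 / real q ^ m) \<longlonglongrightarrow> 0"
  proof (rule Lim_null_comparison[OF _ null])
    have "\<bar>nilpotent_pair_prob K V (W n) - 1 / real q ^ m\<bar> \<le> real q ^ m / real q ^ n" if "m \<le> n" for n
      using nilpotent_pair_prob_bound[OF assms(5,6,8,9,3), of n] that assms(7,10) card_V card_W by simp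
    then show "\<forall>\<^sub>F n in sequentially. norm (nilpotent_pair_prob K V (W n) - 1 / real q ^ m) \<le> real q ^ m * inverse (real q ^ n)"
      by (auto simp: eventually_sequentially divide_inverse)
  qed
  then show ?thesis
    by (simp add: LIM_zero_iff power_int_minus divide_inverse)
qed

end
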